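(* Let $\bm\rho^n=(\rho^n_i)_{i=0}^{N-1}$ satisfy $\bm\rho^n>0$ componentwise, and let the edge coefficients $\gamma^n_{i+\frac12}=\gamma_{i+\frac12}(\bm\rho^n)$ satisfy $\gamma^n_{i+\frac12}\ge 0$ for every edge. Let $A_h(\bm\rho^n)$ be the generator assembled from the frozen rates $F^n_{i+\frac12}=\frac{1}{h^2}\gamma^n_{i+\frac12}e^{V_i}$, $B^n_{i+\frac12}=\frac1{h^2}\gamma^n_{i+\frac12}e^{V_{i+1}}$. Then, for every $\Delta t>0$, the frozen-coefficient semi-implicit scheme $$\bigl(I-\Delta t\,A_h(\bm\rho^n)\bigr)\bm\rho^{n+1}=\bm\rho^n$$ has a unique solution, and it satisfies $$\bm\rho^{n+1}>0\ \text{(componentwise)},\qquad h\sum_i\rho_i^{n+1}=h\sum_i\rho_i^n,\qquad \mathcal{F}_h[\bm\rho^{n+1}]\le\mathcal{F}_h[\bm\rho^n];$$ in particular, the discrete free energy is non-increasing.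
   Context: The scheme discretizes $\rho_t=\partial_x(m(\rho,x)\,\partial_x\mu)$, $\mu=\ln\rho+V$, with a nonlinear, possibly degenerate mobility $m\ge0$, on a uniform one-dimensional grid with spacing $h=1/N$ and periodic indexing modulo $N$ (a no-flux boundary corresponds to setting the wrap-around edge rates to zero). The numbers $V_i\in\mathbb{R}$ are nodal potential values. The discrete free energy is $\mathcal{F}_h[\bm\rho]=h\sum_{i=0}^{N-1}(\rho_i\ln\rho_i-\rho_i+\rho_iV_i)$. The mobility enters only through the edge coefficients $\gamma_{i+\frac12}(\bm\rho)$, e.g. $\gamma_{i+\frac12}(\bm\rho)=m_{i+\frac12}\frac{\mu_{i+1}-\mu_i}{e^{\mu_{i+1}}-e^{\mu_i}}$ (by continuity $m_{i+\frac12}e^{-\mu_i}$ if $\mu_i=\mu_{i+1}$, where $\mu_i=\ln\rho_i+V_i$ and $m_{i+\frac12}\ge0$ is an edge mobility), or $\gamma_{i+\frac12}(\bm\rho)=\widehat a_{i+\frac12}(\bm\rho)e^{-V_{i+\frac12}}$, where $\widehat a_{i+\frac12}\ge0$ is a symmetric mean of the nodal values of $m(\rho,x)/\rho$ and $V_{i+\frac12}$ is a reconstruction of $V$ at the edge midpoint. Given rates $F_{i+\frac12},B_{i+\frac12}$, the generator $A_h$ is the matrix with $(A_h\bm\rho)_i=B_{i+\frac12}\rho_{i+1}-F_{i+\frac12}\rho_i-B_{i-\frac12}\rho_i+F_{i-\frac12}\rho_{i-1}$. *)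

theory Defs
  imports Complex_Main "Jordan_Normal_Form.Matrix"
begin

text \<open>Grid functions are vectors in \<open>carrier_vec N\<close>, nodes are the indices \<open>i < N\<close>, and
  node arithmetic is modulo \<open>N\<close>. The half-integer edge \<open>i + 1/2\<close>, which joins node \<open>i\<close> to
  node \<open>(i + 1) mod N\<close>, is indexed by \<open>i\<close>; in particular edge \<open>N - 1\<close> is the wrap-around edge.\<close>

definition next_node :: "nat \<Rightarrow> nat \<Rightarrow> nat" where
  "next_node N i = (i + 1) mod N"

definition prev_node :: "nat \<Rightarrow> nat \<Rightarrow> nat" where
  "prev_node N i = (i + N - 1) mod N"

definition mesh_size :: "nat \<Rightarrow> real" where
  "mesh_size N = 1 / real N"

text \<open>The contributions are added, rather than chosen by a nested case distinction, because for
  \<open>N \<le> 2\<close> the nodes \<open>i - 1\<close>, \<open>i\<close>, \<open>i + 1\<close> are not distinct modulo \<open>N\<close>.\<close>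

definition generator :: "nat \<Rightarrow> (nat \<Rightarrow> real) \<Rightarrow> (nat \<Rightarrow> real) \<Rightarrow> real mat" where
  "generator N F B = mat N N (\<lambda>(i, j).
      (if j = next_node N i then B i else 0)
    - (if j = i then F i + B (prev_node N i) else 0)
    + (if j = prev_node N i then F (prev_node N i) else 0))"

lemma generator_mult_vec:
  assumes "rho \<in> carrier_vec N" "i < N"
  shows "(generator N F B *\<^sub>v rho) $ i =
      B i * rho $ next_node N i - F i * rho $ i
    - B (prev_node N i) * rho $ i + F (prev_node N i) * rho $ prev_node N i"
proof -
  have n: "next_node N i < N" "prev_node N i < N"
    using assms(2) by (simp_all add: next_node_def prev_node_def)
  have "(generator N F B *\<^sub>v rho) $ i = (\<Sum>j = 0..<N.
      (if j = next_node N i then B i * rho $ j else 0)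
    - (if j = i then (F i + B (prev_node N i)) * rho $ j else 0)
    + (if j = prev_node N i then F (prev_node N i) * rho $ j else 0))"
    using assms by (auto simp: generator_def scalar_prod_def algebra_simps intro!: sum.cong)
  also have "\<dots> = B i * rho $ next_node N i - F i * rho $ i
    - B (prev_node N i) * rho $ i + F (prev_node N i) * rho $ prev_node N i"
    using assms n by (simp add: sum.distrib sum_subtractf algebra_simps)
  finally show ?thesis .
qed

definition forward_rate :: "nat \<Rightarrow> (nat \<Rightarrow> real) \<Rightarrow> (nat \<Rightarrow> real) \<Rightarrow> nat \<Rightarrow> real" where
  "forward_rate N V g i = 1 / (mesh_size N)\<^sup>2 * g i * exp (V i)"

definition backward_rate :: "nat \<Rightarrow> (nat \<Rightarrow> real) \<Rightarrow> (nat \<Rightarrow> real) \<Rightarrow> nat \<Rightarrow> real" where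
  "backward_rate N V g i = 1 / (mesh_size N)\<^sup>2 * g i * exp (V (next_node N i))"

text \<open>\<open>gamma rho i\<close> is the coefficient of edge \<open>i + 1/2\<close> as a function of the whole grid state.\<close>

definition frozen_generator ::
    "nat \<Rightarrow> (nat \<Rightarrow> real) \<Rightarrow> (real vec \<Rightarrow> nat \<Rightarrow> real) \<Rightarrow> real vec \<Rightarrow> real mat" where
  "frozen_generator N V gamma rho =
     generator N (forward_rate N V (gamma rho)) (backward_rate N V (gamma rho))"

definition semi_implicit_step ::
    "nat \<Rightarrow> (nat \<Rightarrow> real) \<Rightarrow> (real vec \<Rightarrow> nat \<Rightarrow> real) \<Rightarrow> real \<Rightarrow> real vec \<Rightarrow> real vec \<Rightarrow> bool" where
  "semi_implicit_step N V gamma dt rho rho' \<longleftrightarrow>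
     rho' \<in> carrier_vec N \<and>
     (1\<^sub>m N - dt \<cdot>\<^sub>m frozen_generator N V gamma rho) *\<^sub>v rho' = rho"

definition discrete_mass :: "nat \<Rightarrow> real vec \<Rightarrow> real" where
  "discrete_mass N rho = mesh_size N * (\<Sum>i<N. rho $ i)"

definition free_energy :: "nat \<Rightarrow> (nat \<Rightarrow> real) \<Rightarrow> real vec \<Rightarrow> real" where
  "free_energy N V rho =
     mesh_size N * (\<Sum>i<N. rho $ i * ln (rho $ i) - rho $ i + rho $ i * V i)"

end

theory Submission
  imports Defs "Jordan_Normal_Form.Determinant"
begin

text \<open>In the variables \<open>u i = exp (V i) * rho' $ i\<close> the right-hand side of the scheme is the
  divergence of an edge flux that is a nonnegative coefficient times the difference of \<open>u\<close> across
  the edge: the exponential factors in the forward and backward rates are those of detailed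
  balance. The scheme is thus an implicit Euler step of a weighted discrete heat flow in \<open>u\<close>,
  and all three properties are those of a heat flow.

  Sign: at a node where \<open>u\<close> is minimal, mass enters across both adjacent edges, so \<open>rho'\<close> is
  there at least the old density; hence the minimum of \<open>u\<close> is positive, and with it \<open>u\<close> and
  \<open>rho'\<close> everywhere (\<open>minimum_principle\<close>, \<open>step_positive\<close>). The same argument, applied to a solution of the
  homogeneous equation and to its negative, makes the square system injective, hence uniquely
  solvable (\<open>step_exists_unique\<close>).

  Mass and energy: by summation by parts over the periodic grid (\<open>sum_by_parts_periodic\<close>),
  testing the scheme with the constant \<open>1\<close> gives mass conservation. The chemical potential
  \<open>ln u = ln rho' + V\<close> is the gradient at the new state of the convex energy, so the energy
  increment is at most the pairing of \<open>ln u\<close> with the density increment; by parts this pairing is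
  minus a sum of terms \<open>(u j - u i) * (ln (u j) - ln (u i))\<close> with nonnegative weights, and \<open>ln\<close>
  is increasing.\<close>

section \<open>Periodic grid\<close>

lemma next_node_less: "i < N \<Longrightarrow> next_node N i < N"
  by (simp add: next_node_def)

lemma prev_node_less: "i < N \<Longrightarrow> prev_node N i < N"
  by (simp add: prev_node_def)

lemma next_prev_node: "i < N \<Longrightarrow> next_node N (prev_node N i) = i"
  by (cases i) (auto simp: next_node_def prev_node_def mod_Suc)

lemma prev_next_node: "i < N \<Longrightarrow> prev_node N (next_node N i) = i"
  by (cases "Suc i = N") (auto simp: next_node_def prev_node_def)

lemma sum_by_parts_periodic:
  fixes \<phi> J :: "nat \<Rightarrow> 'a::comm_ring"
  shows "(\<Sum>i<N. \<phi> i * (J i - J (prev_node N i))) = (\<Sum>i<N. J i * (\<phi> i - \<phi> (next_node N i)))"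
proof -
  have "(\<Sum>i<N. \<phi> i * J (prev_node N i)) = (\<Sum>i<N. \<phi> (next_node N i) * J i)"
    by (rule sum.reindex_bij_witness[of _ "next_node N" "prev_node N"])
       (auto simp: next_node_less prev_node_less next_prev_node prev_next_node)
  then show ?thesis
    by (simp add: algebra_simps sum_subtractf)
qed

section \<open>Flux form of the scheme\<close>

text \<open>The sign is such that a positive value moves mass backwards, from the end node of the edge
  to its start node; the time derivative at a node is then the flux ahead minus the flux behind.\<close>

definition edge_flux :: "nat \<Rightarrow> (nat \<Rightarrow> real) \<Rightarrow> (nat \<Rightarrow> real) \<Rightarrow> real vec \<Rightarrow> nat \<Rightarrow> real" where
  "edge_flux N V g rho i = 1 / (mesh_size N)\<^sup>2 * g i *
     (exp (V (next_node N i)) * rho $ next_node N i - exp (V i) * rho $ i)"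

lemma frozen_generator_carrier: "frozen_generator N V gamma rho \<in> carrier_mat N N"
  by (simp add: frozen_generator_def generator_def)

lemma frozen_generator_mult_vec:
  assumes "x \<in> carrier_vec N" "i < N"
  shows "(frozen_generator N V gamma rho *\<^sub>v x) $ i =
    edge_flux N V (gamma rho) x i - edge_flux N V (gamma rho) x (prev_node N i)"
  unfolding frozen_generator_def generator_mult_vec[OF assms]
  using assms
  by (simp add: edge_flux_def forward_rate_def backward_rate_def next_prev_node algebra_simps)

lemma system_mult_vec:
  assumes "x \<in> carrier_vec N" "i < N"
  shows "((1\<^sub>m N - dt \<cdot>\<^sub>m frozen_generator N V gamma rho) *\<^sub>v x) $ i =
    x $ i - dt * (edge_flux N V (gamma rho) x i - edge_flux N V (gamma rho) x (prev_node N i))"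
proof -
  let ?G = "frozen_generator N V gamma rho"
  have "((1\<^sub>m N - dt \<cdot>\<^sub>m ?G) *\<^sub>v x) $ i = (1\<^sub>m N *\<^sub>v x - (dt \<cdot>\<^sub>m ?G) *\<^sub>v x) $ i"
    using assms frozen_generator_carrier[of N V gamma rho]
    by (subst minus_mult_distrib_mat_vec[where nr = N and nc = N]) auto
  also have "\<dots> = x $ i - dt * (?G *\<^sub>v x) $ i"
    using assms frozen_generator_carrier[of N V gamma rho] by auto
  finally show ?thesis
    using frozen_generator_mult_vec[OF assms] by simp
qed

lemma step_nodewise:
  assumes "semi_implicit_step N V gamma dt rho rho'" "i < N"
  shows "rho' $ i = rho $ i +
    dt * (edge_flux N V (gamma rho) rho' i - edge_flux N V (gamma rho) rho' (prev_node N i))"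
  using assms system_mult_vec[of rho' N i dt V gamma rho]
  by (simp add: semi_implicit_step_def)

section \<open>Minimum principle and unique solvability\<close>

text \<open>At a minimum of \<open>exp (V i) * x $ i\<close> the flux behind is nonpositive and the flux ahead
  nonnegative, so the diffusion term can only increase \<open>x\<close> over the data there. Positivity of a
  step and injectivity of the system both follow: data that are positive, or zero, bound the
  minimum from below.\<close>

lemma minimum_principle:
  assumes N: "N \<ge> 1" and x: "x \<in> carrier_vec N"
    and g: "\<forall>i<N. gamma rho i \<ge> 0" and dt: "dt \<ge> 0"
  obtains k where "k < N"
    "((1\<^sub>m N - dt \<cdot>\<^sub>m frozen_generator N V gamma rho) *\<^sub>v x) $ k \<le> x $ k"
    "\<And>i. i < N \<Longrightarrow> exp (V k) * x $ k \<le> exp (V i) * x $ i"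
proof -
  let ?u = "\<lambda>i. exp (V i) * x $ i"
  let ?J = "edge_flux N V (gamma rho) x"
  obtain k where k: "k < N" and min: "\<And>i. i < N \<Longrightarrow> ?u k \<le> ?u i"
    using ex_min_if_finite[of "?u ` {..<N}"] N
    by (auto simp: lessThan_empty_iff not_less)
  have p: "prev_node N k < N" and n: "next_node N k < N"
    using k by (simp_all add: prev_node_less next_node_less)
  have "?J k \<ge> 0"
    using g k min[OF n] by (simp add: edge_flux_def)
  moreover have "?J (prev_node N k) \<le> 0"
    using g p min[OF p]
    by (simp add: edge_flux_def next_prev_node[OF k] divide_nonpos_nonneg mult_nonneg_nonpos)
  ultimately have "dt * (?J k - ?J (prev_node N k)) \<ge> 0"
    using dt by simp
  then show thesis
    using that[OF k _ min] system_mult_vec[OF x k, of dt V gamma rho] by simp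
qed

lemma step_positive:
  assumes "N \<ge> 1" and pos: "\<forall>i<N. rho $ i > 0"
    and "\<forall>i<N. gamma rho i \<ge> 0" "dt \<ge> 0"
    and step: "semi_implicit_step N V gamma dt rho rho'"
  shows "\<forall>i<N. rho' $ i > 0"
proof (intro allI impI)
  fix i assume "i < N"
  obtain k where k: "k < N" "rho $ k \<le> rho' $ k"
    "\<And>i. i < N \<Longrightarrow> exp (V k) * rho' $ k \<le> exp (V i) * rho' $ i"
    using minimum_principle[of N rho' gamma rho dt V] assms
    by (auto simp: semi_implicit_step_def)
  have "0 < exp (V k) * rho' $ k"
    using pos k(1,2) by (meson exp_gt_zero less_le_trans mult_pos_pos)
  also have "\<dots> \<le> exp (V i) * rho' $ i"
    using k(3) \<open>i < N\<close> .
  finally show "rho' $ i > 0"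
    by (simp add: zero_less_mult_iff)
qed

lemma kernel_nonneg:
  assumes "N \<ge> 1" "x \<in> carrier_vec N" "\<forall>i<N. gamma rho i \<ge> 0" "dt \<ge> 0"
    and ker: "(1\<^sub>m N - dt \<cdot>\<^sub>m frozen_generator N V gamma rho) *\<^sub>v x = 0\<^sub>v N"
    and "i < N"
  shows "x $ i \<ge> 0"
proof -
  obtain k where k: "k < N" "0 \<le> x $ k"
    "\<And>i. i < N \<Longrightarrow> exp (V k) * x $ k \<le> exp (V i) * x $ i"
    using minimum_principle[of N x gamma rho dt V] assms by auto
  have "0 \<le> exp (V k) * x $ k"
    using k(2) by simp
  also have "\<dots> \<le> exp (V i) * x $ i"
    using k(3) \<open>i < N\<close> .
  finally show ?thesis
    by (simp add: zero_le_mult_iff)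
qed

lemma nonsingular_ex1_solution:
  fixes A :: "'a::field mat"
  assumes A: "A \<in> carrier_mat n n" and b: "b \<in> carrier_vec n" and det: "det A \<noteq> 0"
  shows "\<exists>!x. x \<in> carrier_vec n \<and> A *\<^sub>v x = b"
proof -
  obtain B where B: "B \<in> carrier_mat n n" "B * A = 1\<^sub>m n" "A * B = 1\<^sub>m n"
    using det_non_zero_imp_unit[OF A det] by (auto simp: Units_def ring_mat_def)
  show ?thesis
  proof (rule ex1I[of _ "B *\<^sub>v b"])
    show "B *\<^sub>v b \<in> carrier_vec n \<and> A *\<^sub>v (B *\<^sub>v b) = b"
      using assoc_mult_mat_vec[OF A B(1) b] A B b by auto
    show "x = B *\<^sub>v b" if "x \<in> carrier_vec n \<and> A *\<^sub>v x = b" for x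
      using assoc_mult_mat_vec[OF B(1) A, of x] that B by auto
  qed
qed

lemma step_exists_unique:
  assumes N: "N \<ge> 1" and rho: "rho \<in> carrier_vec N"
    and g: "\<forall>i<N. gamma rho i \<ge> 0" and dt: "dt \<ge> 0"
  shows "\<exists>!rho'. semi_implicit_step N V gamma dt rho rho'"
proof -
  define A where "A = 1\<^sub>m N - dt \<cdot>\<^sub>m frozen_generator N V gamma rho"
  have A: "A \<in> carrier_mat N N"
    unfolding A_def using frozen_generator_carrier[of N V gamma rho] by auto
  have "x = 0\<^sub>v N" if x: "x \<in> carrier_vec N" and ker: "A *\<^sub>v x = 0\<^sub>v N" for x
  proof (rule eq_vecI)
    fix i assume "i < dim_vec (0\<^sub>v N :: real vec)"
    then have i: "i < N" by simp
    have nonneg: "y $ i \<ge> 0" if "y \<in> carrier_vec N" "A *\<^sub>v y = 0\<^sub>v N" for y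
      using kernel_nonneg[where gamma = gamma and rho = rho, OF N that(1) g dt _ i] that(2)
      unfolding A_def by blast
    have "A *\<^sub>v (- 1 \<cdot>\<^sub>v x) = 0\<^sub>v N"
      using mult_mat_vec[OF A x, of "- 1"] ker by auto
    then have "(- 1 \<cdot>\<^sub>v x) $ i \<ge> 0"
      using nonneg x by simp
    moreover have "x $ i \<ge> 0"
      using nonneg[OF x ker] .
    ultimately show "x $ i = 0\<^sub>v N $ i"
      using i x by simp
  qed (use x in simp)
  then have "det A \<noteq> 0"
    using det_0_iff_vec_prod_zero[OF A] by blast
  from nonsingular_ex1_solution[OF A rho this] show ?thesis
    unfolding semi_implicit_step_def A_def .
qed

section \<open>Mass conservation and energy dissipation\<close>

lemma step_mass:
  assumes "semi_implicit_step N V gamma dt rho rho'"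
  shows "discrete_mass N rho' = discrete_mass N rho"
proof -
  let ?J = "edge_flux N V (gamma rho) rho'"
  have "(\<Sum>i<N. rho' $ i) = (\<Sum>i<N. rho $ i + dt * (?J i - ?J (prev_node N i)))"
    using step_nodewise[OF assms] by (intro sum.cong) auto
  also have "\<dots> = (\<Sum>i<N. rho $ i) + dt * (\<Sum>i<N. 1 * (?J i - ?J (prev_node N i)))"
    by (simp add: sum.distrib sum_distrib_left)
  also have "\<dots> = (\<Sum>i<N. rho $ i)"
    by (subst sum_by_parts_periodic) simp
  finally show ?thesis
    by (simp add: discrete_mass_def)
qed

text \<open>Convexity of \<open>\<lambda>x. x * ln x - x\<close>, which reduces to \<open>ln t \<le> t - 1\<close> at \<open>t = b / a\<close>. The
  tangent is the one at the new value \<open>b\<close>, because the implicit scheme evaluates the flux, and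
  so the dissipation, at the new state.\<close>

lemma entropy_tangent_le:
  fixes a b v :: real
  assumes "a > 0" "b > 0"
  shows "(b * ln b - b + b * v) - (a * ln a - a + a * v) \<le> (ln b + v) * (b - a)"
proof -
  have "ln (b / a) \<le> b / a - 1"
    using assms by (intro ln_le_minus_one) simp
  then have "a * (ln b - ln a) \<le> b - a"
    using assms by (simp add: ln_div field_simps)
  then show ?thesis
    by (simp add: algebra_simps)
qed

lemma diff_mult_ln_diff_nonneg:
  fixes a b :: real
  assumes "a > 0" "b > 0"
  shows "(b - a) * (ln b - ln a) \<ge> 0"
  using assms by (cases "a \<le> b") (auto intro: mult_nonneg_nonneg mult_nonpos_nonpos)

lemma step_energy:
  assumes pos: "\<forall>i<N. rho $ i > 0" and pos': "\<forall>i<N. rho' $ i > 0"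
    and g: "\<forall>i<N. gamma rho i \<ge> 0" and dt: "dt \<ge> 0"
    and step: "semi_implicit_step N V gamma dt rho rho'"
  shows "free_energy N V rho' \<le> free_energy N V rho"
proof -
  let ?J = "edge_flux N V (gamma rho) rho'"
  let ?f = "\<lambda>r i. r $ i * ln (r $ i) - r $ i + r $ i * V i"
  define u where "u i = exp (V i) * rho' $ i" for i
  have u_pos: "u i > 0" if "i < N" for i
    using pos' that by (simp add: u_def)
  have dissipation: "?J i * (ln (u i) - ln (u (next_node N i))) \<le> 0" if i: "i < N" for i
  proof -
    have "0 \<le> 1 / (mesh_size N)\<^sup>2 * gamma rho i"
      using g i by simp
    moreover have "0 \<le> (u (next_node N i) - u i) * (ln (u (next_node N i)) - ln (u i))"
      using u_pos i next_node_less[OF i] by (intro diff_mult_ln_diff_nonneg) auto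
    ultimately have "0 \<le> 1 / (mesh_size N)\<^sup>2 * gamma rho i *
        ((u (next_node N i) - u i) * (ln (u (next_node N i)) - ln (u i)))"
      by (rule mult_nonneg_nonneg)
    also have "\<dots> = - (?J i * (ln (u i) - ln (u (next_node N i))))"
      by (simp add: edge_flux_def u_def algebra_simps diff_divide_distrib)
    finally show ?thesis by simp
  qed
  have "(\<Sum>i<N. ?f rho' i) - (\<Sum>i<N. ?f rho i) = (\<Sum>i<N. ?f rho' i - ?f rho i)"
    by (simp add: sum_subtractf)
  also have "\<dots> \<le> (\<Sum>i<N. ln (u i) * (dt * (?J i - ?J (prev_node N i))))"
  proof (rule sum_mono)
    fix i assume "i \<in> {..<N}"
    then have i: "i < N" by simp
    have "rho' $ i > 0"
      using pos' i by blast
    then have "ln (u i) = ln (rho' $ i) + V i"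
      by (simp add: u_def ln_mult)
    moreover have "rho' $ i - rho $ i = dt * (?J i - ?J (prev_node N i))"
      using step_nodewise[OF step i] by simp
    ultimately show "?f rho' i - ?f rho i \<le> ln (u i) * (dt * (?J i - ?J (prev_node N i)))"
      using entropy_tangent_le[of "rho $ i" "rho' $ i" "V i"] pos pos' i by simp
  qed
  also have "\<dots> = dt * (\<Sum>i<N. ln (u i) * (?J i - ?J (prev_node N i)))"
    by (simp add: sum_distrib_left mult.left_commute)
  also have "\<dots> = dt * (\<Sum>i<N. ?J i * (ln (u i) - ln (u (next_node N i))))"
    by (subst sum_by_parts_periodic) (rule refl)
  also have "\<dots> \<le> 0"
    by (rule mult_nonneg_nonpos[OF dt sum_nonpos]) (simp add: dissipation)
  finally show ?thesis
    unfolding free_energy_def by (intro mult_left_mono) (auto simp: mesh_size_def)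
qed

section \<open>Well-posedness, positivity, mass and energy of the scheme\<close>

theorem proposition5p1:
  fixes N :: nat
    and V :: "nat \<Rightarrow> real"
    and gamma :: "real vec \<Rightarrow> nat \<Rightarrow> real"
    and rho :: "real vec"
    and dt :: real
  assumes "N \<ge> 1"
    and "rho \<in> carrier_vec N"
    and "\<forall>i<N. rho $ i > 0"
    and "\<forall>i<N. gamma rho i \<ge> 0"
    and "dt > 0"
  shows "(\<exists>!rho'. semi_implicit_step N V gamma dt rho rho') \<and>
    (\<forall>rho'. semi_implicit_step N V gamma dt rho rho' \<longrightarrow>
        (\<forall>i<N. rho' $ i > 0) \<and>
        discrete_mass N rho' = discrete_mass N rho \<and>
        free_energy N V rho' \<le> free_energy N V rho) \<and>
    (\<forall>R :: nat \<Rightarrow> real vec.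
        R 0 = rho \<and>
        (\<forall>n. semi_implicit_step N V gamma dt (R n) (R (Suc n))) \<and>
        (\<forall>n. \<forall>i<N. gamma (R n) i \<ge> 0) \<longrightarrow>
        decseq (\<lambda>n. free_energy N V (R n)))"
proof (intro conjI allI impI)
  have dt: "dt \<ge> 0" using assms(5) by simp
  show "\<exists>!rho'. semi_implicit_step N V gamma dt rho rho'"
    using step_exists_unique[where gamma = gamma and rho = rho, OF assms(1,2,4) dt] .
  fix rho' assume step: "semi_implicit_step N V gamma dt rho rho'"
  have pos': "\<forall>i<N. rho' $ i > 0"
    using step_positive[where gamma = gamma and rho = rho, OF assms(1,3,4) dt step] .
  then show "rho' $ i > 0" if "i < N" for i
    using that by blast
  show "discrete_mass N rho' = discrete_mass N rho"
    using step_mass[OF step] .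
  show "free_energy N V rho' \<le> free_energy N V rho"
    using step_energy[where gamma = gamma and rho = rho, OF assms(3) pos' assms(4) dt step] .
next
  fix R :: "nat \<Rightarrow> real vec"
  assume R: "R 0 = rho \<and>
    (\<forall>n. semi_implicit_step N V gamma dt (R n) (R (Suc n))) \<and>
    (\<forall>n. \<forall>i<N. gamma (R n) i \<ge> 0)"
  have dt: "dt \<ge> 0" using assms(5) by simp
  have step: "semi_implicit_step N V gamma dt (R n) (R (Suc n))"
    and g: "\<forall>i<N. gamma (R n) i \<ge> 0" for n
    using R by auto
  have pos: "\<forall>i<N. R n $ i > 0" for n
  proof (induction n)
    case 0
    show ?case using R assms(3) by simp
  next
    case (Suc n)
    show ?case using step_positive[where gamma = gamma and rho = "R n", OF assms(1) Suc g dt step] .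
  qed
  show "decseq (\<lambda>n. free_energy N V (R n))"
  proof (rule decseq_SucI)
    show "free_energy N V (R (Suc n)) \<le> free_energy N V (R n)" for n
      using step_energy[where gamma = gamma and rho = "R n", OF pos pos g dt step] .
  qed
qed

end
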